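(* Let $\lambda\in\mathbb{R}$, let $\omega=u+\mathrm i v$ be the coordinate on $\mathbb{C}\setminus\{0\}$, and consider the immersion $X=X(u,v)$ into $\mathbb{R}^4$ with $$X_u-\mathrm i X_v=\Bigl(\tfrac12 f(1-g^2-h^2),\ \tfrac{\mathrm i}{2}f(1+g^2+h^2),\ fg,\ fh\Bigr),$$ where $f=2\bigl(1-(u+\mathrm i v)^{-4}\bigr)$, $g=g_1+\mathrm i g_2$, $h=\lambda(h_1+\mathrm i h_2)$. Then the first-order partial derivative $X_u=(X_{u_1},X_{u_2},X_{u_3},X_{u_4})$ is given by $$\begin{aligned} X_{u_1}&=g_2^2-g_1^2-\lambda^2h_1^2+\lambda^2h_2^2+1+\frac{1}{(u^2+v^2)^4}\Big(u^4g_1^2-u^4g_2^2+v^4g_1^2-v^4g_2^2+6u^2v^2-u^4-v^4\\ &\quad-6u^2v^2g_1^2+6u^2v^2g_2^2+u^4\lambda^2h_1^2+v^4\lambda^2h_1^2+u^4\lambda^2h_2^2+v^4\lambda^2h_2^2-8uv^3g_1g_2+8u^3vg_1g_2\\ &\quad-6u^2v^2\lambda^2h_1^2+6u^2v^2\lambda^2h_2^2-8uv^3\lambda^2h_1h_2+8u^3v\lambda^2h_1h_2\Big),\\ X_{u_2}&=-2g_1g_2-2\lambda^2h_1h_2+\frac{2}{(u^2+v^2)^4}\Big(2uv^3-2u^3v+u^4g_1g_2+v^4g_1g_2+2uv^3g_1^2+2uv^3g_2^2\\ &\quad-2u^3vg_1^2-2u^3vg_2^2+6u^2vg_1g_2+u^4\lambda^2h_1h_2+v^4\lambda^2h_1h_2+2uv^3\lambda^2h_1^2+2uv^3\lambda^2h_2^2\\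 &\quad-2u^3v\lambda^2h_1^2-2u^3v\lambda^2h_2^2-6u^2v\lambda^2h_1h_2\Big),\\ X_{u_3}&=2g_1-\frac{2}{(u^2+v^2)^4}\Big(u^4g_1+v^4g_1-6u^2v^2g_1-4uv^3g_2+4u^3vg_2\Big),\\ X_{u_4}&=2\lambda h_1-\frac{2\lambda}{(u^2+v^2)^4}\Big(u^4h_1+v^4h_1-6u^2v^2h_1-4uv^3h_2+4u^3vh_2\Big), \end{aligned}$$ and $X_v=(X_{v_1},X_{v_2},X_{v_3},X_{v_4})$ is given by $$\begin{aligned} X_{v_1}&=2g_1g_2+2\lambda^2h_1h_2-\frac{2}{(u^2+v^2)^4}\Big(-2uv^3+2u^3v+u^4g_1g_2+v^4g_1g_2+2uv^3g_1^2+2uv^3g_2^2\\ &\quad-2u^3vg_1^2-2u^3vg_2^2+6u^2vg_1g_2+u^4\lambda^2h_1h_2+v^4\lambda^2h_1h_2+2uv^3\lambda^2h_1^2+2uv^3\lambda^2h_2^2\\ &\quad-2u^3v\lambda^2h_1^2-2u^3v\lambda^2h_2^2-6u^2v\lambda^2h_1h_2\Big),\\ X_{v_2}&=-g_1^2+g_2^2-\lambda^2h_1^2+\lambda^2h_2^2-1+\frac{1}{(u^2+v^2)^4}\Big(u^4g_1^2+u^4g_2^2+v^4g_1^2+v^4g_2^2+6u^2v^2g_1^2+6u^2v^2g_2^2\\ &\quad+u^4\lambda^2h_1^2+u^4\lambda^2h_2^2+v^4\lambda^2h_1^2+v^4\lambda^2h_2^2-8uv^3g_1g_2+8u^3vg_1g_2\\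 &\quad-6u^2v^2\lambda^2h_1^2+6u^2v^2\lambda^2h_2^2-8uv^3\lambda^2h_1h_2+8u^3v\lambda^2h_1h_2\Big),\\ X_{v_3}&=-2g_2+\frac{2}{(u^2+v^2)^4}\Big(u^4g_2+v^4g_2-6u^2v^2g_2+4uv^3g_1-4u^3vg_1\Big),\\ X_{v_4}&=-2\lambda h_2+\frac{2\lambda}{(u^2+v^2)^4}\Big(u^4h_2+v^4h_2-6u^2v^2h_2+4uv^3h_1-4u^3vh_1\Big). \end{aligned}$$ Put $\psi_1=(-X_{u_2},X_{u_1},-X_{u_4},X_{u_3})$, which is orthogonal to $X_u$, and $\psi_2=(-X_{v_2},X_{v_1},-X_{v_4},X_{v_3})$, which is orthogonal to $X_v$. Then $$\mathbf p=\langle X_u,X_u\rangle=(\mathfrak A+1)(\mathfrak B+1)(\mathfrak C+1)\mathfrak D=\langle X_v,X_v\rangle=\langle\psi_1,\psi_1\rangle=\langle\psi_2,\psi_2\rangle,$$ $$\mathbf q=\langle X_u,\psi_2\rangle=(\mathfrak A+1)(-\mathfrak B+1)(\mathfrak C+1)\mathfrak D=-\langle X_v,\psi_1\rangle,$$ where $$\mathfrak A=(u^2+v^2)^4-2(u^2+v^2)^2+16u^2v^2,\qquad \mathfrak B=(-g_1+\lambda h_2)^2+(g_2+\lambda h_1)^2,$$ $$\mathfrak C=(g_1+\lambda h_2)^2+(-g_2+\lambda h_1)^2,\qquad \mathfrak D=(u^2+v^2)^{-4}.$$ Applying the Gram–Schmidt process, with $\mathbf e_1=\mathbf p^{-1/2}X_u$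 and $\mathbf e_2=\mathbf p^{-1/2}X_v$, yields an orthonormal basis of the normal space, consisting of the normal vectors $$\mathbf n_1=\left(\frac{\mathfrak B+1}{4(\mathfrak A+1)\mathfrak B(\mathfrak C+1)\mathfrak D}\right)^{1/2}\left(\frac{-\mathfrak B+1}{\mathfrak B+1}\,X_v+\psi_1\right),$$ $$\mathbf n_2=\left(\frac{\mathfrak B+1}{4(\mathfrak A+1)\mathfrak B(\mathfrak C+1)\mathfrak D}\right)^{1/2}\left(\frac{\mathfrak B-1}{\mathfrak B+1}\,X_u+\psi_2\right).$$
   Context: $\langle\cdot,\cdot\rangle$ is the standard Euclidean inner product on $\mathbb{R}^4$; $X_u,X_v$ are the partial derivatives of $X$ with respect to $u,v$. The functions $g$ and $h$ are holomorphic, and $g_1,g_2,h_1,h_2$ are real-valued functions of $(u,v)$. The normal space is the orthogonal complement of the span of $X_u,X_v$ in $\mathbb{R}^4$. The case $g(\omega)=\omega$, $h(\omega)=\lambda\omega$ gives the Henneberg-type minimal surface $\mathcal{H}_{(1,1)}$.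
   Formalization: The first two components of X_u and X_v as printed have sign, exponent and missing-term errors (for g=h=0, X_{v_2} is not -1) and are corrected to follow from the defining equation; the Gram–Schmidt claim is made where X is immersive and 𝔅≠0, since n_1, n_2 divide by 𝔅. *)

theory Defs
  imports "HOL-Analysis.Analysis"
begin

(* The library has vector_1, vector_2 and vector_3 only. *)
lemma vector_4 [simp]:
  "(vector [x, y, z, w] :: 'a::zero^4) $ 1 = x"
  "(vector [x, y, z, w] :: 'a::zero^4) $ 2 = y"
  "(vector [x, y, z, w] :: 'a::zero^4) $ 3 = z"
  "(vector [x, y, z, w] :: 'a::zero^4) $ 4 = w"
  unfolding vector_def by simp_all

(* The (u,v)-plane is identified with the complex plane by (u,v) = u + i v. *)

definition partial_u :: "(complex \<Rightarrow> real^4) \<Rightarrow> complex \<Rightarrow> real^4" where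
  "partial_u X \<omega> = vector_derivative (\<lambda>t. X (Complex t (Im \<omega>))) (at (Re \<omega>))"

definition partial_v :: "(complex \<Rightarrow> real^4) \<Rightarrow> complex \<Rightarrow> real^4" where
  "partial_v X \<omega> = vector_derivative (\<lambda>t. X (Complex (Re \<omega>) t)) (at (Im \<omega>))"

definition immersive_at :: "(complex \<Rightarrow> real^4) \<Rightarrow> complex \<Rightarrow> bool" where
  "immersive_at X \<omega> \<longleftrightarrow> X differentiable (at \<omega>) \<and> inj (frechet_derivative X (at \<omega>))"

definition henneberg_f :: "complex \<Rightarrow> complex" where
  "henneberg_f \<omega> = 2 * (1 - \<omega> powi (-4))"

definition weierstrass_data :: "complex \<Rightarrow> complex \<Rightarrow> complex \<Rightarrow> complex^4" where
  "weierstrass_data f g h = vector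
     [1/2 * f * (1 - g^2 - h^2), \<i>/2 * f * (1 + g^2 + h^2), f * g, f * h]"

definition cvec :: "real^4 \<Rightarrow> complex^4" where
  "cvec x = (\<chi> k. complex_of_real (x $ k))"

definition rot :: "real^4 \<Rightarrow> real^4" where
  "rot x = vector [- (x $ 2), x $ 1, - (x $ 4), x $ 3]"

(* Gram-Schmidt with normalisation; the first argument holds the orthonormal vectors
   already produced.  On a linearly dependent input a zero vector is produced. *)
fun gram_schmidt_aux :: "'a::real_inner list \<Rightarrow> 'a list \<Rightarrow> 'a list" where
  "gram_schmidt_aux es [] = es"
| "gram_schmidt_aux es (x # xs) =
     gram_schmidt_aux (es @ [sgn (x - (\<Sum>e\<leftarrow>es. (x \<bullet> e) *\<^sub>R e))]) xs"

definition gram_schmidt :: "'a::real_inner list \<Rightarrow> 'a list" where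
  "gram_schmidt xs = gram_schmidt_aux [] xs"

definition orthonormal_basis_of :: "'a::real_inner list \<Rightarrow> 'a set \<Rightarrow> bool" where
  "orthonormal_basis_of bs S \<longleftrightarrow>
     (\<forall>i < length bs. \<forall>j < length bs. bs ! i \<bullet> bs ! j = (if i = j then 1 else 0)) \<and>
     span (set bs) = S"

(* Explicit partial derivatives for g = g1 + i g2 and h = l (h1 + i h2).  They are the
   real part and minus the imaginary part of the Weierstrass data, expanded with
   (u + i v)^(-4) = (u - i v)^4 / (u^2 + v^2)^4.  The expansions published in the source
   contain misprints in the first two components; here the signs and monomials are the ones
   this computation gives. *)

definition Xu_explicit ::
    "real \<Rightarrow> real \<Rightarrow> real \<Rightarrow> real \<Rightarrow> real \<Rightarrow> real \<Rightarrow> real \<Rightarrow> real^4" where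
  "Xu_explicit l u v g1 g2 h1 h2 = vector
    [g2^2 - g1^2 - l^2*h1^2 + l^2*h2^2 + 1 + 1 / (u^2 + v^2)^4 *
       (u^4*g1^2 - u^4*g2^2 + v^4*g1^2 - v^4*g2^2 + 6*u^2* v^2 - u^4 - v^4
        - 6*u^2* v^2*g1^2 + 6*u^2* v^2*g2^2
        + u^4*l^2*h1^2 + v^4*l^2*h1^2 - u^4*l^2*h2^2 - v^4*l^2*h2^2
        - 8*u* v^3*g1*g2 + 8*u^3* v * g1*g2
        - 6*u^2* v^2*l^2*h1^2 + 6*u^2* v^2*l^2*h2^2
        - 8*u* v^3*l^2*h1*h2 + 8*u^3* v * l^2*h1*h2),
     - 2*g1*g2 - 2*l^2*h1*h2 + 2 / (u^2 + v^2)^4 *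
       (2*u* v^3 - 2*u^3* v + u^4*g1*g2 + v^4*g1*g2 + 2*u* v^3*g1^2 - 2*u* v^3*g2^2
        - 2*u^3* v * g1^2 + 2*u^3* v * g2^2 - 6*u^2* v^2*g1*g2
        + u^4*l^2*h1*h2 + v^4*l^2*h1*h2 + 2*u* v^3*l^2*h1^2 - 2*u* v^3*l^2*h2^2
        - 2*u^3* v * l^2*h1^2 + 2*u^3* v * l^2*h2^2 - 6*u^2* v^2*l^2*h1*h2),
     2*g1 - 2 / (u^2 + v^2)^4 *
       (u^4*g1 + v^4*g1 - 6*u^2* v^2*g1 - 4*u* v^3*g2 + 4*u^3* v * g2),
     2*l*h1 - 2*l / (u^2 + v^2)^4 *
       (u^4*h1 + v^4*h1 - 6*u^2* v^2*h1 - 4*u* v^3*h2 + 4*u^3* v * h2)]"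

definition Xv_explicit ::
    "real \<Rightarrow> real \<Rightarrow> real \<Rightarrow> real \<Rightarrow> real \<Rightarrow> real \<Rightarrow> real \<Rightarrow> real^4" where
  "Xv_explicit l u v g1 g2 h1 h2 = vector
    [2*g1*g2 + 2*l^2*h1*h2 - 2 / (u^2 + v^2)^4 *
       (- 2*u* v^3 + 2*u^3* v + u^4*g1*g2 + v^4*g1*g2 + 2*u* v^3*g1^2 - 2*u* v^3*g2^2
        - 2*u^3* v * g1^2 + 2*u^3* v * g2^2 - 6*u^2* v^2*g1*g2
        + u^4*l^2*h1*h2 + v^4*l^2*h1*h2 + 2*u* v^3*l^2*h1^2 - 2*u* v^3*l^2*h2^2
        - 2*u^3* v * l^2*h1^2 + 2*u^3* v * l^2*h2^2 - 6*u^2* v^2*l^2*h1*h2),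
     - (g1^2) + g2^2 - l^2*h1^2 + l^2*h2^2 - 1 + 1 / (u^2 + v^2)^4 *
       (u^4 + v^4 - 6*u^2* v^2
        + u^4*g1^2 - u^4*g2^2 + v^4*g1^2 - v^4*g2^2 - 6*u^2* v^2*g1^2 + 6*u^2* v^2*g2^2
        + u^4*l^2*h1^2 - u^4*l^2*h2^2 + v^4*l^2*h1^2 - v^4*l^2*h2^2
        - 8*u* v^3*g1*g2 + 8*u^3* v * g1*g2
        - 6*u^2* v^2*l^2*h1^2 + 6*u^2* v^2*l^2*h2^2
        - 8*u* v^3*l^2*h1*h2 + 8*u^3* v * l^2*h1*h2),
     - 2*g2 + 2 / (u^2 + v^2)^4 *
       (u^4*g2 + v^4*g2 - 6*u^2* v^2*g2 + 4*u* v^3*g1 - 4*u^3* v * g1),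
     - 2*l*h2 + 2*l / (u^2 + v^2)^4 *
       (u^4*h2 + v^4*h2 - 6*u^2* v^2*h2 + 4*u* v^3*h1 - 4*u^3* v * h1)]"

end

theory Submission
  imports Defs
begin

text \<open>
  Write \<open>X\<^sub>u - \<i> X\<^sub>v = W\<close>, where \<open>W\<close> is the Weierstrass vector built from \<open>f\<close>, \<open>g\<close>, \<open>h\<close>.
  The metric quantities become transparent in the null coordinates
  \<open>W\<^sub>1 - \<i> W\<^sub>2 = f\<close>, \<open>W\<^sub>1 + \<i> W\<^sub>2 = - f (g + \<i> h) (g - \<i> h)\<close> and
  \<open>W\<^sub>3 \<plusminus> \<i> W\<^sub>4 = f (g \<plusminus> \<i> h)\<close>.
  The sum of the four squared moduli factors as
  \<open>|f|\<^sup>2 (1 + |g + \<i> h|\<^sup>2) (1 + |g - \<i> h|\<^sup>2)\<close> and equals \<open>4p\<close>, while \<open>W\<close> is isotropic, so the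
  coordinates are isothermal.  The map \<^const>\<open>rot\<close> is an orthogonal complex structure; the
  squared moduli of \<open>W\<^sub>1 - \<i> W\<^sub>2\<close> and \<open>W\<^sub>3 - \<i> W\<^sub>4\<close> minus those of the other two sum up to
  \<open>4q\<close>, and this turns the first factor into \<open>1 - |g + \<i> h|\<^sup>2\<close>
  (\<open>weierstrass_data_inner\<close>).  For the given data \<open>B = |g + \<i> h|\<^sup>2\<close>, \<open>C = |g - \<i> h|\<^sup>2\<close>, and
  \<open>|f|\<^sup>2 / 4 = |\<omega>\<^sup>4 - 1|\<^sup>2 / |\<omega>|\<^sup>8 = (A + 1) D\<close> (\<open>henneberg_f_norm\<close>).

  It remains to run Gram-Schmidt on two orthogonal vectors of the same squared length \<open>p > 0\<close>
  and their images under \<^const>\<open>rot\<close> (\<open>gram_schmidt_rot\<close>).  The only parameter is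
  \<open>r = q / p = (1 - B) / (1 + B)\<close>, the cosine of the Kaehler angle of the tangent plane, and the
  normal vectors have squared length \<open>p (1 - r\<^sup>2)\<close> before normalisation.  This vanishes exactly
  for \<open>B = 0\<close>, when the tangent plane is invariant under \<^const>\<open>rot\<close> and \<open>\<psi>\<^sub>1\<close>, \<open>\<psi>\<^sub>2\<close> are
  tangential.  Positivity of \<open>p\<close> is where the immersion hypothesis enters.
\<close>

section \<open>The rotation and the metric coefficients\<close>

lemma vec4_eq_iff:
  "x = y \<longleftrightarrow> x $ 1 = y $ 1 \<and> x $ 2 = y $ 2 \<and> x $ 3 = y $ 3 \<and> x $ 4 = y $ 4"
  for x y :: "'a^4"
  by (simp add: vec_eq_iff forall_4)

lemma inner_vec4:
  "x \<bullet> y = x $ 1 * y $ 1 + x $ 2 * y $ 2 + x $ 3 * y $ 3 + x $ 4 * y $ 4"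
  for x y :: "real^4"
  by (simp add: inner_vec_def sum_4)

lemma inner_rot_rot: "rot x \<bullet> rot y = x \<bullet> y"
  by (simp add: inner_vec4 rot_def)

lemma inner_rot_swap: "rot x \<bullet> y = - (x \<bullet> rot y)"
  by (simp add: inner_vec4 rot_def)

lemma inner_rot_self: "rot x \<bullet> x = 0"
  by (simp add: inner_vec4 rot_def)

lemma cvec_diff_eq_iff:
  "cvec x - \<i> *s cvec y = z \<longleftrightarrow> (\<forall>k. x $ k = Re (z $ k) \<and> y $ k = - Im (z $ k))"
  by (auto simp: vec_eq_iff cvec_def complex_eq_iff minus_equation_iff[of "y $ _"])

text \<open>Here \<open>g + \<i> h\<close> and \<open>g - \<i> h\<close> are the stereographic coordinates of the two factors of the
  Gauss map into the Grassmannian of oriented planes in four-space, a product of two spheres.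
  The induced metric is symmetric in them; pairing with \<^const>\<open>rot\<close> sees the height on one
  sphere only, which is why a single sign changes between the first and the last identity.\<close>
lemma weierstrass_data_inner:
  assumes "cvec x - \<i> *s cvec y = weierstrass_data f g h"
  shows "x \<bullet> x = (cmod f)\<^sup>2 / 4 * (1 + (cmod (g + \<i> * h))\<^sup>2) * (1 + (cmod (g - \<i> * h))\<^sup>2)"
    and "y \<bullet> y = x \<bullet> x" and "x \<bullet> y = 0"
    and "x \<bullet> rot y = (cmod f)\<^sup>2 / 4 * (1 - (cmod (g + \<i> * h))\<^sup>2) * (1 + (cmod (g - \<i> * h))\<^sup>2)"
proof -
  obtain a b where f: "f = Complex a b" by (cases f)
  obtain c d where g: "g = Complex c d" by (cases g)
  obtain m n where h: "h = Complex m n" by (cases h)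
  have x: "x $ k = Re (weierstrass_data f g h $ k)"
    and y: "y $ k = - Im (weierstrass_data f g h $ k)" for k
    using assms by (simp_all add: cvec_diff_eq_iff)
  have xs: "x $ 1 = (a * (1 - (c\<^sup>2 - d\<^sup>2) - (m\<^sup>2 - n\<^sup>2)) + b * (2 * c * d + 2 * m * n)) / 2"
    "x $ 2 = - (a * (2 * c * d + 2 * m * n) + b * (1 + (c\<^sup>2 - d\<^sup>2) + (m\<^sup>2 - n\<^sup>2))) / 2"
    "x $ 3 = a * c - b * d" "x $ 4 = a * m - b * n"
    unfolding x f g h weierstrass_data_def
    by (simp_all add: power2_eq_square field_simps)
  have ys: "y $ 1 = (a * (2 * c * d + 2 * m * n) - b * (1 - (c\<^sup>2 - d\<^sup>2) - (m\<^sup>2 - n\<^sup>2))) / 2"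
    "y $ 2 = - (a * (1 + (c\<^sup>2 - d\<^sup>2) + (m\<^sup>2 - n\<^sup>2)) - b * (2 * c * d + 2 * m * n)) / 2"
    "y $ 3 = - (a * d + b * c)" "y $ 4 = - (a * n + b * m)"
    unfolding y f g h weierstrass_data_def
    by (simp_all add: power2_eq_square field_simps)
  have n: "(cmod f)\<^sup>2 = a\<^sup>2 + b\<^sup>2" "(cmod (g + \<i> * h))\<^sup>2 = (c - n)\<^sup>2 + (d + m)\<^sup>2"
    "(cmod (g - \<i> * h))\<^sup>2 = (c + n)\<^sup>2 + (d - m)\<^sup>2"
    by (simp_all add: f g h cmod_power2)
  show "x \<bullet> x = (cmod f)\<^sup>2 / 4 * (1 + (cmod (g + \<i> * h))\<^sup>2) * (1 + (cmod (g - \<i> * h))\<^sup>2)"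
    unfolding n inner_vec4 xs by (simp add: field_simps) algebra
  show "y \<bullet> y = x \<bullet> x"
    unfolding inner_vec4 xs ys by (simp add: field_simps) algebra
  show "x \<bullet> y = 0"
    unfolding inner_vec4 xs ys by (simp add: field_simps) algebra
  show "x \<bullet> rot y = (cmod f)\<^sup>2 / 4 * (1 - (cmod (g + \<i> * h))\<^sup>2) * (1 + (cmod (g - \<i> * h))\<^sup>2)"
    unfolding n inner_vec4 rot_def vector_4 xs ys by (simp add: field_simps) algebra
qed

section \<open>The Henneberg data\<close>

lemma henneberg_f_eq:
  assumes "Complex u v \<noteq> 0"
  shows "henneberg_f (Complex u v) =
    Complex (2 - 2 * ((u^4 - 6 * u\<^sup>2 * v\<^sup>2 + v^4) / (u\<^sup>2 + v\<^sup>2)^4))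
            (2 * ((4 * u^3 * v - 4 * u * v^3) / (u\<^sup>2 + v\<^sup>2)^4))"
proof -
  let ?w = "Complex u v"
  have "?w powi (-4) = inverse (?w ^ 4)" by (simp add: power_int_def power_inverse)
  also have "\<dots> = cnj ?w ^ 4 / of_real ((u\<^sup>2 + v\<^sup>2)^4)"
  proof -
    have "?w * cnj ?w = of_real (u\<^sup>2 + v\<^sup>2)"
      by (simp add: complex_mult_cnj)
    then have "?w ^ 4 * cnj ?w ^ 4 = of_real ((u\<^sup>2 + v\<^sup>2)^4)"
      by (metis of_real_power power_mult_distrib)
    moreover have "complex_of_real ((u\<^sup>2 + v\<^sup>2)^4) \<noteq> 0"
      using assms by (simp only: of_real_eq_0_iff) (simp add: complex_eq_iff)
    moreover have "inverse a = b / r" if "a * b = r" "r \<noteq> 0" for a b r :: complex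
      using that by (auto simp: field_simps)
    ultimately show ?thesis by blast
  qed
  also have "cnj ?w ^ 4 = Complex (u^4 - 6 * u\<^sup>2 * v\<^sup>2 + v^4) (4 * u * v^3 - 4 * u^3 * v)"
    by (simp add: complex_eq_iff power4_eq_xxxx power2_eq_square power3_eq_cube algebra_simps)
  finally show ?thesis
    unfolding henneberg_f_def by (simp add: complex_eq_iff diff_divide_distrib)
qed

text \<open>With \<open>n = u\<^sup>2 + v\<^sup>2\<close>, the real part of \<open>\<omega>\<^sup>4\<close> is \<open>n\<^sup>2 - 8 u\<^sup>2 v\<^sup>2\<close>, hence
  \<open>|\<omega>\<^sup>4 - 1|\<^sup>2 = n\<^sup>4 - 2 n\<^sup>2 + 16 u\<^sup>2 v\<^sup>2 + 1\<close>.\<close>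
lemma henneberg_f_norm:
  assumes "Complex u v \<noteq> 0"
  shows "(cmod (henneberg_f (Complex u v)))\<^sup>2 / 4 =
    ((u\<^sup>2 + v\<^sup>2)^4 - 2 * (u\<^sup>2 + v\<^sup>2)\<^sup>2 + 16 * u\<^sup>2 * v\<^sup>2 + 1) * (u\<^sup>2 + v\<^sup>2) powi (-4)"
proof -
  define k where "k = inverse ((u\<^sup>2 + v\<^sup>2)^4)"
  have "u\<^sup>2 + v\<^sup>2 \<noteq> 0" using assms by (simp add: complex_eq_iff)
  then have k: "k * (u\<^sup>2 + v\<^sup>2)^4 = 1" by (simp add: k_def)
  have D: "(u\<^sup>2 + v\<^sup>2) powi (-4) = k" by (simp add: k_def power_int_def power_inverse)
  have f: "henneberg_f (Complex u v) =
      Complex (2 - 2 * ((u^4 - 6 * u\<^sup>2 * v\<^sup>2 + v^4) * k)) (2 * ((4 * u^3 * v - 4 * u * v^3) * k))"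
    unfolding henneberg_f_eq[OF assms] k_def by (simp add: divide_inverse)
  have "(2 - 2 * ((u^4 - 6 * u\<^sup>2 * v\<^sup>2 + v^4) * k))\<^sup>2 + (2 * ((4 * u^3 * v - 4 * u * v^3) * k))\<^sup>2 =
    4 * (((u\<^sup>2 + v\<^sup>2)^4 - 2 * (u\<^sup>2 + v\<^sup>2)\<^sup>2 + 16 * u\<^sup>2 * v\<^sup>2 + 1) * k)"
    using k by algebra
  then show ?thesis unfolding f D by (simp add: cmod_power2)
qed

lemma henneberg_partials:
  assumes "cvec x - \<i> *s cvec y =
      weierstrass_data (henneberg_f (Complex u v)) (Complex a b) (of_real l * Complex c d)"
    and "Complex u v \<noteq> 0"
  shows "x = Xu_explicit l u v a b c d" and "y = Xv_explicit l u v a b c d"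
proof -
  \<comment> \<open>Treating the reciprocal as an indeterminate leaves polynomial goals.\<close>
  define k where "k = inverse ((u\<^sup>2 + v\<^sup>2)^4)"
  have f: "henneberg_f (Complex u v) =
      Complex (2 - 2 * ((u^4 - 6 * u\<^sup>2 * v\<^sup>2 + v^4) * k)) (2 * ((4 * u^3 * v - 4 * u * v^3) * k))"
    unfolding henneberg_f_eq[OF assms(2)] k_def by (simp add: divide_inverse)
  have x: "x $ k = Re (weierstrass_data (henneberg_f (Complex u v)) (Complex a b) (of_real l * Complex c d) $ k)"
    and y: "y $ k = - Im (weierstrass_data (henneberg_f (Complex u v)) (Complex a b) (of_real l * Complex c d) $ k)" for k
    using assms(1) by (simp_all add: cvec_diff_eq_iff)
  have k: "1 / (u\<^sup>2 + v\<^sup>2)^4 = k" "r / (u\<^sup>2 + v\<^sup>2)^4 = r * k" for r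
    by (simp_all add: k_def divide_inverse)
  show "x = Xu_explicit l u v a b c d"
    unfolding vec4_eq_iff x f Xu_explicit_def weierstrass_data_def vector_4 k
    by (intro conjI; simp add: power2_eq_square; algebra)
  show "y = Xv_explicit l u v a b c d"
    unfolding vec4_eq_iff y f Xv_explicit_def weierstrass_data_def vector_4 k
    by (intro conjI; simp add: power2_eq_square; algebra)
qed

section \<open>Frames of the tangent and normal planes\<close>

text \<open>By the chain rule \<^const>\<open>partial_u\<close> is the differential applied to \<open>1\<close>.\<close>
lemma immersive_at_partial_u_nonzero:
  assumes "immersive_at X \<omega>"
  shows "partial_u X \<omega> \<noteq> 0"
proof
  assume *: "partial_u X \<omega> = 0"
  let ?F = "frechet_derivative X (at \<omega>)"
  have F: "(X has_derivative ?F) (at \<omega>)" and inj: "inj ?F"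
    using assms frechet_derivative_works by (auto simp: immersive_at_def)
  have line: "((\<lambda>t. Complex t (Im \<omega>)) has_derivative of_real) (at (Re \<omega>))"
  proof -
    have "((\<lambda>t. of_real t + Complex 0 (Im \<omega>)) has_derivative of_real) (at (Re \<omega>))"
      by (auto intro!: derivative_eq_intros)
    also have "(\<lambda>t. of_real t + Complex 0 (Im \<omega>)) = (\<lambda>t. Complex t (Im \<omega>))"
      by (auto simp: complex_eq_iff)
    finally show ?thesis .
  qed
  have "((\<lambda>t. X (Complex t (Im \<omega>))) has_derivative (\<lambda>t. ?F (of_real t))) (at (Re \<omega>))"
    using has_derivative_compose[OF line, of X ?F] F by simp
  moreover have "?F (of_real t) = t *\<^sub>R ?F 1" for t
    using linear_cmul[OF has_derivative_linear[OF F], of t 1] by (simp add: scaleR_conv_of_real)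
  ultimately have "((\<lambda>t. X (Complex t (Im \<omega>))) has_vector_derivative ?F 1) (at (Re \<omega>))"
    by (simp add: has_vector_derivative_def)
  then have "?F 1 = 0" using * by (simp add: partial_u_def vector_derivative_at)
  also have "0 = ?F 0" using linear_0[OF has_derivative_linear[OF F]] by simp
  finally show False using inj by (simp add: inj_eq)
qed

text \<open>Four orthonormal vectors span the whole space for dimension reasons, and a vector
  orthogonal to the first two has vanishing coefficients on them.\<close>
lemma orthonormal_basis_of_orthogonal_comp:
  fixes a b c d :: "real^4"
  assumes "orthonormal_basis_of [a, b, c, d] S"
  shows "orthonormal_basis_of [a, b] (span {a, b})"
    and "orthonormal_basis_of [c, d] ((span {a, b})\<^sup>\<bottom>)"
proof -
  have o: "\<forall>i < 4. \<forall>j < 4. [a, b, c, d] ! i \<bullet> [a, b, c, d] ! j = (if i = j then 1 else 0)"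
    using assms by (simp add: orthonormal_basis_of_def)
  have ip: "a \<bullet> a = 1" "b \<bullet> b = 1" "c \<bullet> c = 1" "d \<bullet> d = 1"
    "a \<bullet> b = 0" "a \<bullet> c = 0" "a \<bullet> d = 0" "b \<bullet> c = 0" "b \<bullet> d = 0" "c \<bullet> d = 0"
    using o by (simp_all add: numeral_eq_Suc All_less_Suc)
  have ip': "b \<bullet> a = 0" "c \<bullet> a = 0" "d \<bullet> a = 0" "c \<bullet> b = 0" "d \<bullet> b = 0" "d \<bullet> c = 0"
    using ip(5-10) by (simp_all add: inner_commute)
  have on2: "\<forall>i < length [p, q]. \<forall>j < length [p, q]. [p, q] ! i \<bullet> [p, q] ! j = (if i = j then 1 else 0)"
    if "p \<bullet> p = 1" "q \<bullet> q = 1" "p \<bullet> q = 0" for p q :: "real^4"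
    using that by (auto simp: less_Suc_eq inner_commute)
  show "orthonormal_basis_of [a, b] (span {a, b})"
    using on2[of a b] ip by (simp add: orthonormal_basis_of_def)
  have dist: "distinct [a, b, c, d]" using ip ip' by auto
  have "pairwise orthogonal {a, b, c, d}" using ip ip' by (auto simp: pairwise_def orthogonal_def)
  moreover have "0 \<notin> {a, b, c, d}" using ip by auto
  ultimately have "independent {a, b, c, d}" by (rule pairwise_orthogonal_independent)
  then have "dim {a, b, c, d} = 4" using dist by (simp add: dim_eq_card_independent)
  then have full: "span {a, b, c, d} = UNIV"
    by (simp flip: dim_eq_full)
  have "span {c, d} = (span {a, b})\<^sup>\<bottom>"
  proof
    have "span {c, d} \<subseteq> ({a, b})\<^sup>\<bottom>"
      using ip ip' by (intro span_minimal subspace_orthogonal_comp) (auto simp: orthogonal_comp_def orthogonal_def)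
    also have "({a, b})\<^sup>\<bottom> \<subseteq> (span {a, b})\<^sup>\<bottom>"
      unfolding orthogonal_comp_def using orthogonal_to_span orthogonal_commute by blast
    finally show "span {c, d} \<subseteq> (span {a, b})\<^sup>\<bottom>" .
    show "(span {a, b})\<^sup>\<bottom> \<subseteq> span {c, d}"
    proof
      fix y assume "y \<in> (span {a, b})\<^sup>\<bottom>"
      then have y: "a \<bullet> y = 0" "b \<bullet> y = 0"
        by (auto simp: orthogonal_comp_def orthogonal_def span_base)
      have "y \<in> span {a, b, c, d}" using full by simp
      then obtain r s t where "y - r *\<^sub>R a - s *\<^sub>R b - t *\<^sub>R c \<in> span {d}"
        by (auto simp: span_insert)
      then obtain w where "y - r *\<^sub>R a - s *\<^sub>R b - t *\<^sub>R c = w *\<^sub>R d"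
        by (auto simp: span_singleton)
      then have eq: "y = r *\<^sub>R a + s *\<^sub>R b + (t *\<^sub>R c + w *\<^sub>R d)"
        by (simp add: algebra_simps)
      have "r = 0" "s = 0" using y ip ip' by (simp_all add: eq inner_simps)
      then show "y \<in> span {c, d}"
        unfolding eq by (simp add: span_add span_scale span_base)
    qed
  qed
  then show "orthonormal_basis_of [c, d] ((span {a, b})\<^sup>\<bottom>)"
    using on2[of c d] ip by (simp add: orthonormal_basis_of_def)
qed

lemma sgn_eq_scaleR:
  fixes z :: "'a::real_inner"
  assumes "a > 0" and "a * a * (z \<bullet> z) = 1"
  shows "sgn z = a *\<^sub>R z"
proof -
  have "(a * norm z)\<^sup>2 = 1"
    using assms(2) by (simp add: power_mult_distrib power2_norm_eq_inner power2_eq_square[of a])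
  moreover have "a * norm z \<ge> 0" using assms(1) by simp
  ultimately have "a * norm z = 1" by (simp add: power2_eq_1_iff)
  moreover from this have "norm z \<noteq> 0" by auto
  ultimately show ?thesis by (simp add: sgn_div_norm field_simps)
qed

text \<open>The map \<^const>\<open>rot\<close> is skew, so \<open>rot x\<close> has no component along \<open>x\<close> and \<open>rot y\<close> none
  along \<open>y\<close>; being an isometry as well, it keeps \<open>rot x\<close> and \<open>rot y\<close> orthogonal.  Hence
  every Gram-Schmidt step subtracts at most one term, \<open>\<plusminus>r\<close> times \<open>x\<close> or \<open>y\<close>, and both normal
  directions have squared length \<open>p * (1 - r\<^sup>2)\<close>.\<close>
lemma gram_schmidt_rot:
  fixes x y :: "real^4"
  assumes p: "x \<bullet> x = p" "y \<bullet> y = p" "p > 0" and xy: "x \<bullet> y = 0"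
    and q: "x \<bullet> rot y = r * p" and r: "r\<^sup>2 < 1"
  defines "c \<equiv> 1 / sqrt (p * (1 - r\<^sup>2))"
  defines "e1 \<equiv> p powr (-1/2) *\<^sub>R x" and "e2 \<equiv> p powr (-1/2) *\<^sub>R y"
    and "n1 \<equiv> c *\<^sub>R (r *\<^sub>R y + rot x)" and "n2 \<equiv> c *\<^sub>R ((- r) *\<^sub>R x + rot y)"
  shows "gram_schmidt [x, y, rot x, rot y] = [e1, e2, n1, n2]"
    and "orthonormal_basis_of [e1, e2] (span {x, y})"
    and "orthonormal_basis_of [n1, n2] ((span {x, y})\<^sup>\<bottom>)"
proof -
  define s where "s = p powr (-1/2)"
  have s: "s = 1 / sqrt p" using p(3) powr_minus_divide[of p "1/2"] by (simp add: s_def powr_half_sqrt)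
  have e1: "e1 = s *\<^sub>R x" and e2: "e2 = s *\<^sub>R y"
    by (simp_all only: e1_def e2_def s_def)
  have ss: "s * s * p = 1" using p(3) by (simp add: s)
  have spos: "s > 0" using p(3) by (simp add: s)
  have cpos: "p * (1 - r\<^sup>2) > 0" using p(3) r by simp
  then have cc: "c * c * (p * (1 - r\<^sup>2)) = 1"
    unfolding c_def times_divide_times_eq real_sqrt_mult_self abs_of_pos[OF cpos] by auto
  have ip: "x \<bullet> x = p" "y \<bullet> y = p" "x \<bullet> y = 0" "y \<bullet> x = 0"
    "x \<bullet> rot x = 0" "rot x \<bullet> x = 0" "y \<bullet> rot y = 0" "rot y \<bullet> y = 0"
    "x \<bullet> rot y = r * p" "rot y \<bullet> x = r * p" "rot x \<bullet> y = - (r * p)" "y \<bullet> rot x = - (r * p)"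
    "rot x \<bullet> rot x = p" "rot y \<bullet> rot y = p" "rot x \<bullet> rot y = 0" "rot y \<bullet> rot x = 0"
    using p(1,2) xy q inner_rot_swap[of x y] inner_rot_self[of x] inner_rot_self[of y]
    by (simp_all add: inner_rot_rot inner_commute)
  have cp: "c > 0" using cpos by (simp add: c_def)
  have E1: "sgn x = e1" unfolding e1 by (rule sgn_eq_scaleR) (use spos ss ip in auto)
  have E2: "sgn y = e2" unfolding e2 by (rule sgn_eq_scaleR) (use spos ss ip in auto)
  have N1: "sgn (r *\<^sub>R y + rot x) = n1" unfolding n1_def
    by (rule sgn_eq_scaleR) (use cp cc in \<open>simp_all add: inner_simps ip power2_eq_square algebra_simps\<close>)
  have N2: "sgn ((- r) *\<^sub>R x + rot y) = n2" unfolding n2_def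
    by (rule sgn_eq_scaleR) (use cp cc in \<open>simp_all add: inner_simps ip power2_eq_square algebra_simps\<close>)
  have proj: "rot x \<bullet> e1 = 0" "(rot x \<bullet> e2) *\<^sub>R e2 = - (r *\<^sub>R y)" "y \<bullet> e1 = 0"
    "(rot y \<bullet> e1) *\<^sub>R e1 = r *\<^sub>R x" "rot y \<bullet> e2 = 0" "rot y \<bullet> n1 = 0"
    using ss by (simp_all add: e1 e2 n1_def inner_simps ip mult_ac)
  show "gram_schmidt [x, y, rot x, rot y] = [e1, e2, n1, n2]"
    unfolding gram_schmidt_def
    using N1 N2 by (simp add: E1 E2 proj add.commute)
  have on: "e1 \<bullet> e1 = 1" "e2 \<bullet> e2 = 1" "n1 \<bullet> n1 = 1" "n2 \<bullet> n2 = 1"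
    "e1 \<bullet> e2 = 0" "e1 \<bullet> n1 = 0" "e1 \<bullet> n2 = 0" "e2 \<bullet> n1 = 0" "e2 \<bullet> n2 = 0" "n1 \<bullet> n2 = 0"
    using ss cc
    by (simp_all add: e1 e2 n1_def n2_def inner_simps ip
        power2_eq_square algebra_simps)
  have basis: "orthonormal_basis_of [e1, e2, n1, n2] (span {e1, e2, n1, n2})"
    using on by (auto simp: orthonormal_basis_of_def less_Suc_eq inner_commute)
  have "span {e1, e2} = span {x, y}"
  proof -
    have "{e1, e2} = (*\<^sub>R) s ` {x, y}" by (simp add: e1 e2)
    then show ?thesis using span_image_scale[of "{x, y}" "\<lambda>_. s"] spos by simp
  qed
  then show "orthonormal_basis_of [e1, e2] (span {x, y})"
    and "orthonormal_basis_of [n1, n2] ((span {x, y})\<^sup>\<bottom>)"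
    using orthonormal_basis_of_orthogonal_comp[OF basis] by simp_all
qed

theorem mainTheorem2:
  fixes X :: "complex \<Rightarrow> real^4"
    and g h :: "complex \<Rightarrow> complex"
    and g1 g2 h1 h2 :: "complex \<Rightarrow> real"
    and l :: real
    and \<Omega> :: "complex set"
    and u v :: real
  assumes "open \<Omega>" and "\<Omega> \<subseteq> - {0}"
    and "g holomorphic_on \<Omega>" and "h holomorphic_on \<Omega>"
    and "\<And>\<omega>. \<omega> \<in> \<Omega> \<Longrightarrow> g \<omega> = complex_of_real (g1 \<omega>) + \<i> * complex_of_real (g2 \<omega>)"
    and "\<And>\<omega>. \<omega> \<in> \<Omega> \<Longrightarrow>
           h \<omega> = complex_of_real l * (complex_of_real (h1 \<omega>) + \<i> * complex_of_real (h2 \<omega>))"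
    and "X differentiable_on \<Omega>"
    and "\<And>\<omega>. \<omega> \<in> \<Omega> \<Longrightarrow>
           cvec (partial_u X \<omega>) - \<i> *s cvec (partial_v X \<omega>) =
             weierstrass_data (henneberg_f \<omega>) (g \<omega>) (h \<omega>)"
    and "Complex u v \<in> \<Omega>"
  shows
    "let \<omega> = Complex u v;
         X\<^sub>u = partial_u X \<omega>;
         X\<^sub>v = partial_v X \<omega>;
         \<psi>\<^sub>1 = rot X\<^sub>u;
         \<psi>\<^sub>2 = rot X\<^sub>v;
         p = X\<^sub>u \<bullet> X\<^sub>u;
         q = X\<^sub>u \<bullet> \<psi>\<^sub>2;
         A = (u^2 + v^2)^4 - 2 * (u^2 + v^2)^2 + 16 * u^2 * v^2;
         B = (- g1 \<omega> + l * h2 \<omega>)^2 + (g2 \<omega> + l * h1 \<omega>)^2;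
         C = (g1 \<omega> + l * h2 \<omega>)^2 + (- g2 \<omega> + l * h1 \<omega>)^2;
         D = (u^2 + v^2) powi (-4);
         e\<^sub>1 = p powr (-1/2) *\<^sub>R X\<^sub>u;
         e\<^sub>2 = p powr (-1/2) *\<^sub>R X\<^sub>v;
         c = sqrt ((B + 1) / (4 * (A + 1) * B * (C + 1) * D));
         n\<^sub>1 = c *\<^sub>R (((- B + 1) / (B + 1)) *\<^sub>R X\<^sub>v + \<psi>\<^sub>1);
         n\<^sub>2 = c *\<^sub>R (((B - 1) / (B + 1)) *\<^sub>R X\<^sub>u + \<psi>\<^sub>2)
     in
       X\<^sub>u = Xu_explicit l u v (g1 \<omega>) (g2 \<omega>) (h1 \<omega>) (h2 \<omega>) \<and>
       X\<^sub>v = Xv_explicit l u v (g1 \<omega>) (g2 \<omega>) (h1 \<omega>) (h2 \<omega>) \<and>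
       orthogonal \<psi>\<^sub>1 X\<^sub>u \<and>
       orthogonal \<psi>\<^sub>2 X\<^sub>v \<and>
       p = (A + 1) * (B + 1) * (C + 1) * D \<and>
       p = X\<^sub>v \<bullet> X\<^sub>v \<and>
       p = \<psi>\<^sub>1 \<bullet> \<psi>\<^sub>1 \<and>
       p = \<psi>\<^sub>2 \<bullet> \<psi>\<^sub>2 \<and>
       q = (A + 1) * (- B + 1) * (C + 1) * D \<and>
       q = - (X\<^sub>v \<bullet> \<psi>\<^sub>1) \<and>
       (immersive_at X \<omega> \<and> B \<noteq> 0 \<longrightarrow>
          gram_schmidt [X\<^sub>u, X\<^sub>v, \<psi>\<^sub>1, \<psi>\<^sub>2] = [e\<^sub>1, e\<^sub>2, n\<^sub>1, n\<^sub>2] \<and>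
          orthonormal_basis_of [e\<^sub>1, e\<^sub>2] (span {X\<^sub>u, X\<^sub>v}) \<and>
          orthonormal_basis_of [n\<^sub>1, n\<^sub>2] ((span {X\<^sub>u, X\<^sub>v})\<^sup>\<bottom>))"
proof -
  let ?\<omega> = "Complex u v"
  define x where "x = partial_u X ?\<omega>"
  define y where "y = partial_v X ?\<omega>"
  define A where "A = (u^2 + v^2)^4 - 2 * (u^2 + v^2)^2 + 16 * u^2 * v^2"
  define B where "B = (- g1 ?\<omega> + l * h2 ?\<omega>)^2 + (g2 ?\<omega> + l * h1 ?\<omega>)^2"
  define C where "C = (g1 ?\<omega> + l * h2 ?\<omega>)^2 + (- g2 ?\<omega> + l * h1 ?\<omega>)^2"
  define D where "D = (u^2 + v^2) powi (-4)"
  have nz: "?\<omega> \<noteq> 0" using assms(2,9) by auto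
  have g: "g ?\<omega> = Complex (g1 ?\<omega>) (g2 ?\<omega>)"
    and h: "h ?\<omega> = of_real l * Complex (h1 ?\<omega>) (h2 ?\<omega>)"
    using assms(5,6)[OF assms(9)] by (simp_all add: complex_eq_iff)
  have W: "cvec x - \<i> *s cvec y = weierstrass_data (henneberg_f ?\<omega>) (g ?\<omega>) (h ?\<omega>)"
    unfolding x_def y_def by (rule assms(8)[OF assms(9)])
  note explicit = henneberg_partials[OF W[unfolded g h] nz]
  have BC: "(cmod (g ?\<omega> + \<i> * h ?\<omega>))\<^sup>2 = B" "(cmod (g ?\<omega> - \<i> * h ?\<omega>))\<^sup>2 = C"
    unfolding g h B_def C_def cmod_power2 by (simp_all add: power2_eq_square algebra_simps)
  have f: "(cmod (henneberg_f ?\<omega>))\<^sup>2 / 4 = (A + 1) * D"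
    unfolding A_def D_def by (rule henneberg_f_norm[OF nz])
  note inner = weierstrass_data_inner[OF W, unfolded BC f]
  have p: "x \<bullet> x = (A + 1) * (B + 1) * (C + 1) * D"
    and q: "x \<bullet> rot y = (A + 1) * (- B + 1) * (C + 1) * D"
    using inner by (simp_all add: algebra_simps)
  define c where "c = sqrt ((B + 1) / (4 * (A + 1) * B * (C + 1) * D))"
  have gs: "gram_schmidt [x, y, rot x, rot y] =
        [(x \<bullet> x) powr (-1/2) *\<^sub>R x, (x \<bullet> x) powr (-1/2) *\<^sub>R y,
         c *\<^sub>R (((- B + 1) / (B + 1)) *\<^sub>R y + rot x), c *\<^sub>R (((B - 1) / (B + 1)) *\<^sub>R x + rot y)] \<and>
      orthonormal_basis_of [(x \<bullet> x) powr (-1/2) *\<^sub>R x, (x \<bullet> x) powr (-1/2) *\<^sub>R y] (span {x, y}) \<and>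
      orthonormal_basis_of [c *\<^sub>R (((- B + 1) / (B + 1)) *\<^sub>R y + rot x),
         c *\<^sub>R (((B - 1) / (B + 1)) *\<^sub>R x + rot y)] ((span {x, y})\<^sup>\<bottom>)"
    if imm: "immersive_at X ?\<omega>" and "B \<noteq> 0"
  proof -
    define r where "r = (- B + 1) / (B + 1)"
    have Bpos: "B > 0" using \<open>B \<noteq> 0\<close> unfolding B_def by (simp add: less_le)
    have xx: "x \<bullet> x > 0" using immersive_at_partial_u_nonzero[OF imm] by (simp add: x_def)
    have r': "- r = (B - 1) / (B + 1)" by (simp add: r_def minus_divide_left)
    have r2: "1 - r\<^sup>2 = 4 * B / (B + 1)\<^sup>2"
      using Bpos by (simp add: r_def power_divide diff_divide_eq_iff) (simp add: power2_eq_square algebra_simps)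
    have "r\<^sup>2 < 1" using r2 Bpos by (smt (verit) divide_pos_pos zero_less_power)
    have "x \<bullet> rot y = r * (x \<bullet> x)" using Bpos unfolding p q r_def by simp
    have "c = 1 / sqrt (x \<bullet> x * (1 - r\<^sup>2))"
    proof -
      have "x \<bullet> x * (1 - r\<^sup>2) = 4 * (A + 1) * B * (C + 1) * D / (B + 1)"
      proof -
        have "(A + 1) * t * (C + 1) * D * (4 * B / t\<^sup>2) = 4 * (A + 1) * B * (C + 1) * D / t"
          if "t \<noteq> 0" for t
          using that by (simp add: power2_eq_square field_simps)
        then show ?thesis using Bpos unfolding r2 p by simp
      qed
      then show ?thesis by (simp add: c_def real_sqrt_divide)
    qed
    then show ?thesis
      using gram_schmidt_rot[OF refl inner(2) xx inner(3) \<open>x \<bullet> rot y = r * (x \<bullet> x)\<close> \<open>r\<^sup>2 < 1\<close>]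
      unfolding r' r_def[symmetric] by simp
  qed
  show ?thesis
    unfolding Let_def x_def[symmetric] y_def[symmetric] A_def[symmetric] B_def[symmetric]
      C_def[symmetric] D_def[symmetric] c_def[symmetric]
    using explicit p q inner(2) gs inner_rot_self inner_rot_swap[of x y]
    by (auto simp: orthogonal_def inner_rot_rot inner_commute)
qed

end
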